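(* For each integer $d\ge 0$, we have $\tilde{A}_d=A_d\cap\hat{A}_d$; that is, a sequence is a self-modified $d$-ascent sequence if and only if it is both a $d$-ascent sequence and a modified $d$-ascent sequence.
   Context: All sequences are finite words $\alpha=a_1\ldots a_n$ ($n\ge 0$) of positive integers; $\epsilon$ is the empty word. For an integer $d\ge 0$, an index $i\in[n]$ is a $d$-ascent of $\alpha$ if $i=1$, or $i\ge 2$ and $a_i>a_{i-1}-d$. Let $\mathrm{Asc}_d\alpha$ be the set of $d$-ascents and $\mathrm{asc}_d\alpha=\#\mathrm{Asc}_d\alpha$. The word $\alpha$ is a $d$-ascent sequence if $a_i\le 1+\mathrm{asc}_d(a_1\ldots a_{i-1})$ for every $i\in[n]$ (with $\mathrm{asc}_d\epsilon=0$); $A_d$ denotes the set of all $d$-ascent sequences (of all lengths $n\ge0$). For a word $\alpha$ and an index $j$, let $M(\alpha,j)$ be the word obtained from $\alpha$ by adding $1$ to every entry $a_i$ with $i<j$ and $a_i\ge a_j$; set $M(\alpha,j_1,\dots,j_k)=M(M(\alpha,j_1,\dots,j_{k-1}),j_k)$. For $\alpha\in A_d$, define $\mathrm{hat}_d(\alpha)=M(\alpha,j_1,\dots,j_k)$ where $j_1<\dots<j_k$ are the elements of $\mathrm{Asc}_d\alpha$. The set of modified $d$-ascent sequences is $\hat{A}_d=\{\mathrm{hat}_d(\alpha):\alpha\in A_d\}$, and the set of self-modified $d$-ascent sequences is $\tilde{A}_d=\{\alpha\in A_d:\mathrm{hat}_d(\alpha)=\alpha\}$. *)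

theory Defs
  imports Main
begin

text \<open>
  Words \<open>a\<^sub>1 \<dots> a\<^sub>n\<close> are lists over \<^typ>\<open>nat\<close>; positivity of the entries is imposed in
  \<open>is_ascent_seq\<close>. List positions start at 0, so every position below is the usual index
  minus one; in particular \<open>i = 0\<close> is the first position, which is always a d-ascent.
\<close>

text \<open>The comparison is made in \<^typ>\<open>int\<close> because the difference may be negative.\<close>

definition Asc :: "nat \<Rightarrow> nat list \<Rightarrow> nat set" where
  "Asc d \<alpha> = {i. i < length \<alpha> \<and> (i = 0 \<or> int (\<alpha> ! i) > int (\<alpha> ! (i - 1)) - int d)}"

definition asc :: "nat \<Rightarrow> nat list \<Rightarrow> nat" where
  "asc d \<alpha> = card (Asc d \<alpha>)"

definition is_ascent_seq :: "nat \<Rightarrow> nat list \<Rightarrow> bool" where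
  "is_ascent_seq d \<alpha> \<longleftrightarrow> (\<forall>i < length \<alpha>. 1 \<le> \<alpha> ! i \<and> \<alpha> ! i \<le> 1 + asc d (take i \<alpha>))"

definition ascent_seqs :: "nat \<Rightarrow> nat list set" where
  "ascent_seqs d = {\<alpha>. is_ascent_seq d \<alpha>}"

definition M :: "nat list \<Rightarrow> nat \<Rightarrow> nat list" where
  "M \<alpha> j = map (\<lambda>i. if i < j \<and> \<alpha> ! i \<ge> \<alpha> ! j then \<alpha> ! i + 1 else \<alpha> ! i) [0..<length \<alpha>]"

text \<open>
  The ascent positions are those of the original word; they are not recomputed
  between successive applications of \<^const>\<open>M\<close>.
\<close>

definition hat :: "nat \<Rightarrow> nat list \<Rightarrow> nat list" where
  "hat d \<alpha> = foldl M \<alpha> (sorted_list_of_set (Asc d \<alpha>))"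

definition modified_ascent_seqs :: "nat \<Rightarrow> nat list set" where
  "modified_ascent_seqs d = hat d ` ascent_seqs d"

definition self_modified_ascent_seqs :: "nat \<Rightarrow> nat list set" where
  "self_modified_ascent_seqs d = {\<alpha> \<in> ascent_seqs d. hat d \<alpha> = \<alpha>}"

end

theory Submission
  imports Defs
begin

text \<open>
  Processing a d-ascent \<open>j\<close> makes the \<open>j\<close>-th entry different from all earlier ones, and later
  steps preserve this, while a position that is not a d-ascent stays one that is not. Hence in
  \<open>\<alpha> = hat d \<beta>\<close> the entries at d-ascents of \<open>\<alpha>\<close> are first occurrences. If moreover \<open>\<alpha>\<close> is a d-ascent
  sequence, its \<open>t\<close>-th d-ascent carries a value in \<open>{1..t}\<close>; being distinct, these values are
  exactly \<open>1, 2, 3, \<dots>\<close>, so every d-ascent is a strict left-to-right maximum and \<open>M\<close> never changes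
  anything.
\<close>

lemma length_M [simp]: "length (M \<alpha> j) = length \<alpha>"
  by (simp add: M_def)

lemma nth_M:
  "i < length \<alpha> \<Longrightarrow> M \<alpha> j ! i = (if i < j \<and> \<alpha> ! i \<ge> \<alpha> ! j then \<alpha> ! i + 1 else \<alpha> ! i)"
  by (simp add: M_def)

lemma length_foldl_M [simp]: "length (foldl M \<alpha> js) = length \<alpha>"
  by (induction js arbitrary: \<alpha>) auto

lemma length_hat [simp]: "length (hat d \<alpha>) = length \<alpha>"
  by (simp add: hat_def)

lemma finite_Asc [simp]: "finite (Asc d \<alpha>)"
  by (simp add: Asc_def)

lemma not_Asc_iff:
  assumes "i < length \<alpha>"
  shows "i \<notin> Asc d \<alpha> \<longleftrightarrow> 0 < i \<and> \<alpha> ! i + d \<le> \<alpha> ! (i - 1)"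
  using assms by (auto simp: Asc_def)

text \<open>If a step at \<open>j\<close> raises the entry at \<open>k\<close>, then
  \<open>k < j\<close> and that entry is at least \<open>\<alpha> ! j\<close>; the entry at
  \<open>k - 1\<close> is no smaller, so it is raised too.\<close>

lemma foldl_M_keeps_descent:
  assumes "k \<notin> set js" "0 < k" "k < length \<alpha>" "\<alpha> ! k + d \<le> \<alpha> ! (k - 1)"
  shows "foldl M \<alpha> js ! k + d \<le> foldl M \<alpha> js ! (k - 1)"
  using assms
proof (induction js arbitrary: \<alpha>)
  case (Cons j js)
  then have "M \<alpha> j ! k + d \<le> M \<alpha> j ! (k - 1)"
    by (auto simp: nth_M)
  with Cons show ?case by simp
qed simp

text \<open>Transfers facts about the d-ascents of \<open>\<beta>\<close>, where \<open>hat\<close>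
  acts, to those of the resulting word.\<close>

lemma Asc_hat_subset: "Asc d (hat d \<beta>) \<subseteq> Asc d \<beta>"
proof
  fix k assume k: "k \<in> Asc d (hat d \<beta>)"
  then have len: "k < length \<beta>" by (auto simp: Asc_def)
  show "k \<in> Asc d \<beta>"
  proof (rule ccontr)
    assume nk: "k \<notin> Asc d \<beta>"
    then have "hat d \<beta> ! k + d \<le> hat d \<beta> ! (k - 1)"
      unfolding hat_def using len by (intro foldl_M_keeps_descent) (auto simp: not_Asc_iff)
    moreover have "0 < k" using nk len by (simp add: not_Asc_iff)
    ultimately show False using k len not_Asc_iff[of k "hat d \<beta>" d] by simp
  qed
qed

text \<open>On the entries before \<open>j\<close>, a step at \<open>j\<close> applies the map
  adding 1 to every value that is at least \<open>\<alpha> ! j\<close>. This map is strictly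
  increasing, hence injective.\<close>

lemma foldl_M_keeps_neq:
  assumes "\<forall>l \<in> set js. i < l \<and> k < l" "i < length \<alpha>" "k < length \<alpha>" "\<alpha> ! i \<noteq> \<alpha> ! k"
  shows "foldl M \<alpha> js ! i \<noteq> foldl M \<alpha> js ! k"
  using assms
proof (induction js arbitrary: \<alpha>)
  case (Cons j js)
  then have "M \<alpha> j ! i \<noteq> M \<alpha> j ! k"
    by (auto simp: nth_M)
  with Cons show ?case by simp
qed simp

lemma hat_neq_at_Asc:
  assumes j: "j \<in> Asc d \<beta>" and i: "i < j"
  shows "hat d \<beta> ! i \<noteq> hat d \<beta> ! j"
proof -
  have len: "j < length \<beta>" using j by (simp add: Asc_def)
  have "j \<in> set (sorted_list_of_set (Asc d \<beta>))" using j by simp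
  then obtain xs ys where split: "sorted_list_of_set (Asc d \<beta>) = xs @ j # ys"
    by (meson split_list)
  have "sorted_wrt (<) (xs @ j # ys)"
    by (metis split strict_sorted_list_of_set)
  then have ys: "\<forall>l \<in> set ys. j < l" by (simp add: sorted_wrt_append)
  \<comment> \<open>Whatever the steps in \<open>xs\<close> did, this step leaves the entry at
    \<open>j\<close> alone and lifts every earlier entry equal to it.\<close>
  have "M (foldl M \<beta> xs) j ! i \<noteq> M (foldl M \<beta> xs) j ! j"
    using i len by (auto simp: nth_M)
  then have "foldl M (M (foldl M \<beta> xs) j) ys ! i \<noteq> foldl M (M (foldl M \<beta> xs) j) ys ! j"
    using ys i len by (intro foldl_M_keeps_neq) auto
  then show ?thesis by (simp add: hat_def split)
qed

lemma Asc_take: "Asc d (take k \<alpha>) = Asc d \<alpha> \<inter> {..<k}"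
  by (auto simp: Asc_def)

lemma asc_take_Suc:
  "asc d (take (Suc k) \<alpha>) = (if k \<in> Asc d \<alpha> then Suc (asc d (take k \<alpha>)) else asc d (take k \<alpha>))"
  by (simp add: asc_def Asc_take lessThan_Suc)

lemma asc_take_mono: "k \<le> l \<Longrightarrow> asc d (take k \<alpha>) \<le> asc d (take l \<alpha>)"
  unfolding asc_def Asc_take by (intro card_mono) auto

text \<open>At a d-ascent, the 1 in the defining bound counts position \<open>i\<close> itself.
  Elsewhere the entry is at most its predecessor, which obeys the bound by induction.\<close>

lemma is_ascent_seq_nth_le:
  assumes "is_ascent_seq d \<alpha>" "i < length \<alpha>"
  shows "\<alpha> ! i \<le> asc d (take (Suc i) \<alpha>)"
  using assms(2)
proof (induction i)
  case 0
  then show ?case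
    using assms(1) by (auto simp: asc_take_Suc is_ascent_seq_def Asc_def)
next
  case (Suc i)
  show ?case
  proof (cases "Suc i \<in> Asc d \<alpha>")
    case True
    then show ?thesis
      using assms(1) Suc.prems by (simp add: asc_take_Suc[of d "Suc i"] is_ascent_seq_def)
  next
    case False
    then have "\<alpha> ! Suc i \<le> \<alpha> ! i"
      using Suc.prems by (simp add: not_Asc_iff)
    then show ?thesis
      using Suc False by (simp add: asc_take_Suc[of d "Suc i"])
  qed
qed

lemma Asc_left_to_right_max:
  assumes seq: "is_ascent_seq d \<alpha>"
    and first: "\<And>i j. j \<in> Asc d \<alpha> \<Longrightarrow> i < j \<Longrightarrow> \<alpha> ! i \<noteq> \<alpha> ! j"
    and j: "j \<in> Asc d \<alpha>" and i: "i < j"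
  shows "\<alpha> ! i < \<alpha> ! j"
proof -
  let ?P = "Asc d \<alpha> \<inter> {..<j}" and ?a = "asc d (take j \<alpha>)"
  have len: "j < length \<alpha>" using j by (simp add: Asc_def)
  have le: "\<alpha> ! l \<le> ?a" if "l < j" for l
    using that len is_ascent_seq_nth_le[OF seq, of l] asc_take_mono[of "Suc l" j d \<alpha>] by simp
  have inj: "inj_on ((!) \<alpha>) ?P"
    by (rule linorder_inj_onI') (use first in auto)
  \<comment> \<open>Pigeonhole: \<open>?P\<close> has \<open>?a\<close> elements, and their values
    are distinct and lie in \<open>{1..?a}\<close>.\<close>
  have "(!) \<alpha> ` ?P = {1..?a}"
  proof (rule card_subset_eq)
    show "(!) \<alpha> ` ?P \<subseteq> {1..?a}"
      using le seq len by (auto simp: is_ascent_seq_def)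
    show "card ((!) \<alpha> ` ?P) = card {1..?a}"
      using card_image[OF inj] by (simp add: asc_def Asc_take)
  qed simp
  moreover have "\<alpha> ! j \<notin> (!) \<alpha> ` ?P" using first[OF j] by force
  moreover have "1 \<le> \<alpha> ! j" using seq len by (simp add: is_ascent_seq_def)
  \<comment> \<open>All values up to \<open>?a\<close> are taken, so the new value at
    \<open>j\<close> exceeds \<open>?a\<close>, which bounds every earlier entry, at d-ascents or
    not.\<close>
  ultimately have "?a < \<alpha> ! j" by simp
  with le[OF i] show ?thesis by simp
qed

lemma foldl_fixed: "(\<And>x. x \<in> set xs \<Longrightarrow> f a x = a) \<Longrightarrow> foldl f a xs = a"
  by (induction xs) auto

text \<open>No entry before a d-ascent \<open>j\<close> is large enough for \<open>M\<close> to
  raise it, so each step starts from \<open>\<alpha>\<close> and returns it.\<close>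

lemma hat_eq_self:
  assumes "\<And>i j. j \<in> Asc d \<alpha> \<Longrightarrow> i < j \<Longrightarrow> \<alpha> ! i < \<alpha> ! j"
  shows "hat d \<alpha> = \<alpha>"
  unfolding hat_def
proof (rule foldl_fixed)
  fix j assume "j \<in> set (sorted_list_of_set (Asc d \<alpha>))"
  then have "j \<in> Asc d \<alpha>" by simp
  from assms[OF this] show "M \<alpha> j = \<alpha>"
    by (intro nth_equalityI) (auto simp: nth_M simp flip: not_less)
qed

theorem theorem3p4:
  fixes d :: nat
  shows "self_modified_ascent_seqs d = ascent_seqs d \<inter> modified_ascent_seqs d"
proof
  show "self_modified_ascent_seqs d \<subseteq> ascent_seqs d \<inter> modified_ascent_seqs d"
    by (force simp: self_modified_ascent_seqs_def modified_ascent_seqs_def)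
  show "ascent_seqs d \<inter> modified_ascent_seqs d \<subseteq> self_modified_ascent_seqs d"
  proof
    fix \<alpha> assume \<alpha>: "\<alpha> \<in> ascent_seqs d \<inter> modified_ascent_seqs d"
    then obtain \<beta> where \<beta>: "\<alpha> = hat d \<beta>"
      by (auto simp: modified_ascent_seqs_def)
    have "\<alpha> ! i \<noteq> \<alpha> ! j" if "j \<in> Asc d \<alpha>" "i < j" for i j
      using that Asc_hat_subset[of d \<beta>] hat_neq_at_Asc[of j d \<beta> i] \<beta> by auto
    then have "hat d \<alpha> = \<alpha>"
      using \<alpha> by (intro hat_eq_self Asc_left_to_right_max) (auto simp: ascent_seqs_def)
    with \<alpha> show "\<alpha> \<in> self_modified_ascent_seqs d"
      by (simp add: self_modified_ascent_seqs_def)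
  qed
qed

end
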